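(* Let $d\geq 2$ and let $f:[0,4]\to(-\infty,\infty)$ be non-increasing and convex on $(0,4]$, differentiable in $(0,4)$ with a convex derivative $f'$ on $(0,4)$, and such that $\lim_{t\to 0^+}f(t)=f(0)$. Let $\omega_d^\ast$ be the set of vertices of a regular $d$-simplex inscribed in $S^{d-1}$. Then $$P_f(\omega_d,S^{d-1})\leq P_f(\omega_d^\ast,S^{d-1})\qquad(\ast)$$ for every $(d+1)$-point configuration $\omega_d\subset S^{d-1}$. Furthermore, $$\mathcal P_f(S^{d-1})=P_f(\omega_d^\ast,S^{d-1})=f(0)+d\cdot f\left(2+\frac{2}{d}\right).$$ If the convexity of $f$ is strict on $(0,4]$, then equality in $(\ast)$ holds if and only if $\omega_d$ is the set of vertices of a regular $d$-simplex inscribed in $S^{d-1}$.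
   Context: $S^{d-1}=\{\mathbf x\in\mathbb R^d: |\mathbf x|=1\}$, where $|\cdot|$ is the Euclidean norm. A $(d+1)$-point configuration on $S^{d-1}$ is a set $\omega_d=\{\mathbf v_0,\ldots,\mathbf v_d\}\subset S^{d-1}$ of cardinality $d+1$. The vertices of a regular $d$-simplex inscribed in $S^{d-1}$ are $d+1$ points of $S^{d-1}$ whose pairwise distances are all equal (equivalently, distinct vertices have inner product $-1/d$). For a function $f$ on $[0,4]$ define $$p_f(\mathbf x,\omega_d)=\sum_{i=0}^{d} f(|\mathbf x-\mathbf v_i|^2),\ \ \mathbf x\in S^{d-1},\qquad P_f(\omega_d,S^{d-1})=\min_{\mathbf x\in S^{d-1}}p_f(\mathbf x,\omega_d),$$ $$\mathcal P_f(S^{d-1})=\sup\{P_f(\omega_d,S^{d-1}):\omega_d\subset S^{d-1},\ \#\omega_d=d+1\}.$$ *)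

theory Defs
  imports "HOL-Analysis.Analysis"
begin

text \<open>
  The ambient space is \<open>real ^ 'n\<close>, so the dimension is \<open>CARD('n)\<close>; its unit sphere is
  \<open>sphere 0 1\<close>.  A potential is a total function \<open>f\<close>, but only its values on the interval
  from 0 to 4 matter, since squared distances of points of the unit sphere lie there.
\<close>

definition simplex_configuration :: "(real ^ 'n) set \<Rightarrow> bool" where
  "simplex_configuration \<omega> \<longleftrightarrow> \<omega> \<subseteq> sphere 0 1 \<and> card \<omega> = CARD('n) + 1"

definition regular_simplex_vertices :: "(real ^ 'n) set \<Rightarrow> bool" where
  "regular_simplex_vertices \<omega> \<longleftrightarrow>
     simplex_configuration \<omega> \<and> (\<exists>c. \<forall>u\<in>\<omega>. \<forall>v\<in>\<omega>. u \<noteq> v \<longrightarrow> dist u v = c)"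

definition potential :: "(real \<Rightarrow> real) \<Rightarrow> (real ^ 'n) set \<Rightarrow> real ^ 'n \<Rightarrow> real" where
  "potential f \<omega> x = (\<Sum>v\<in>\<omega>. f ((norm (x - v))\<^sup>2))"

text \<open>
  A genuine minimum: \<open>Least\<close> on the reals has the intended value only if the minimum is attained,
  which holds for finite \<open>\<omega>\<close> on the unit sphere as soon as \<open>f\<close> is continuous on the closed
  interval from 0 to 4.
\<close>

definition polarization :: "(real \<Rightarrow> real) \<Rightarrow> (real ^ 'n) set \<Rightarrow> real" where
  "polarization f \<omega> = (LEAST m. m \<in> potential f \<omega> ` sphere 0 1)"

definition max_polarization :: "'n::finite itself \<Rightarrow> (real \<Rightarrow> real) \<Rightarrow> real" where
  "max_polarization _ f = (SUP \<omega> \<in> {\<omega> :: (real ^ 'n) set. simplex_configuration \<omega>}. polarization f \<omega>)"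

definition strictly_convex_on :: "real set \<Rightarrow> (real \<Rightarrow> real) \<Rightarrow> bool" where
  "strictly_convex_on S f \<longleftrightarrow> convex S \<and>
     (\<forall>x\<in>S. \<forall>y\<in>S. \<forall>u>0. \<forall>v>0. x \<noteq> y \<longrightarrow> u + v = 1 \<longrightarrow>
        f (u * x + v * y) < u * f x + v * f y)"

end

theory Submission
  imports Defs
begin

text \<open>
  Write \<open>d\<close> for the dimension and \<open>V = f 0 + d * f (2 + 2 / d)\<close>.  On the unit sphere the squared
  distance of \<open>x\<close> and \<open>v\<close> is \<open>2 - 2 * (x \<bullet> v)\<close>, so everything depends on the inner products of
  \<open>x\<close> with the points of the configuration.

  For a regular simplex, \<open>V\<close> is the value of the potential at each vertex, and it is a lower bound
  by the linear programming argument: the quadratic polynomial that agrees with \<open>f\<close> at \<open>0\<close> and is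
  tangent to it at \<open>2 + 2 / d\<close>, the two squared distances seen from a vertex, lies below \<open>f\<close>
  (lemma \<open>hermite_quadratic_below\<close>), because \<open>f'\<close> is convex.  The potential of a
  quadratic polynomial is constant on the sphere, because the vertices sum to zero and form a tight
  frame (lemma \<open>regular_simplex_frame\<close>).

  For an arbitrary configuration one exhibits a point of the sphere whose potential is at most \<open>V\<close>.
  If the origin is outside the convex hull, some \<open>x\<close> has \<open>x \<bullet> v \<le> 0\<close> for all \<open>v\<close>, whence
  the potential is at most \<open>(d + 1) * f 2\<close>, which convexity bounds by \<open>V\<close>.  Otherwise write the
  origin as a convex combination of the points and let \<open>w\<close> be a point whose weight is at least the
  average \<open>1 / (d + 1)\<close>.  A unit normal \<open>x\<close> of the hyperplane through the other \<open>d\<close> points,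
  oriented away from them, satisfies \<open>x \<bullet> v = - h\<close> for all these points, with \<open>h \<ge> 0\<close>, and
  taking the inner product of the convex combination with \<open>x\<close> shows that \<open>s = x \<bullet> w\<close> is at most
  \<open>d * h\<close>.  The potential at \<open>x\<close> is \<open>f (2 - 2 * s) + d * f (2 + 2 * h)\<close>, and monotonicity and
  convexity bound this by \<open>V\<close> (lemma \<open>two_value_bound\<close>).

  If \<open>f\<close> is strictly convex, equality in the last bound forces \<open>s = 1\<close> and \<open>h = 1 / d\<close>.  Then
  \<open>x = w\<close>, all other points have inner product \<open>- 1 / d\<close> with \<open>w\<close>, and the weight of \<open>w\<close>
  is exactly the average.  So no weight exceeds the average, all weights are equal to it, and the
  argument applies to every point of the configuration.
\<close>

section \<open>Convex decreasing functions on a closed interval\<close>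

lemma antimono_on_include_left_endpoint:
  fixes f :: "real \<Rightarrow> real"
  assumes anti: "antimono_on {0<..b} f" and lim: "(f \<longlongrightarrow> f 0) (at_right 0)"
  shows "antimono_on {0..b} f"
proof (rule monotone_onI)
  fix s t :: real
  assume s: "s \<in> {0..b}" and t: "t \<in> {0..b}" and "s \<le> t"
  show "f t \<le> f s"
  proof (cases "s = 0 \<and> 0 < t")
    case True
    have "\<forall>\<^sub>F e in at_right 0. f t \<le> f e"
    proof -
      have "\<forall>\<^sub>F e in at_right (0::real). e \<in> {0<..<t}"
        using True by (intro eventually_at_right_real) auto
      then show ?thesis
        by eventually_elim (use t in \<open>auto intro!: monotone_onD[OF anti]\<close>)
    qed
    then have "f t \<le> f 0" using lim by (intro tendsto_lowerbound) auto
    then show ?thesis using True by simp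
  next
    case False
    then show ?thesis using s t \<open>s \<le> t\<close>
      by (cases "s = 0") (auto intro!: monotone_onD[OF anti])
  qed
qed

lemma convex_on_include_left_endpoint:
  fixes f :: "real \<Rightarrow> real"
  assumes conv: "convex_on {0<..b} f" and lim: "(f \<longlongrightarrow> f 0) (at_right 0)"
  shows "convex_on {0..b} f"
proof (rule convex_on_linorderI)
  fix u x y :: real
  assume u: "0 < u" "u < 1" and x: "x \<in> {0..b}" and y: "y \<in> {0..b}" and "x < y"
  show "f ((1 - u) *\<^sub>R x + u *\<^sub>R y) \<le> (1 - u) * f x + u * f y"
  proof (cases "x = 0")
    case True
    then have y0: "0 < y" "y \<le> b" using y \<open>x < y\<close> by auto
    have uy: "0 < u * y" "u * y < b" using u y0 by (auto intro: less_le_trans[of _ y])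
    have "continuous_on {0<..<b} f"
      by (rule convex_on_continuous[OF open_greaterThanLessThan])
        (rule convex_on_subset[OF conv], auto)
    then have "isCont f (u * y)" using uy by (auto simp: continuous_on_eq_continuous_at)
    moreover have "((\<lambda>e. (1 - u) * e + u * y) \<longlongrightarrow> u * y) (at_right 0)"
      by (auto intro!: tendsto_eq_intros)
    ultimately have L: "((\<lambda>e. f ((1 - u) * e + u * y)) \<longlongrightarrow> f (u * y)) (at_right 0)"
      by (rule isCont_tendsto_compose)
    have R: "((\<lambda>e. (1 - u) * f e + u * f y) \<longlongrightarrow> (1 - u) * f 0 + u * f y) (at_right 0)"
      by (intro tendsto_intros lim)
    have "\<forall>\<^sub>F e in at_right (0::real). e \<in> {0<..<y}"
      using y0 by (intro eventually_at_right_real) auto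
    then have "\<forall>\<^sub>F e in at_right 0. f ((1 - u) * e + u * y) \<le> (1 - u) * f e + u * f y"
      by eventually_elim (use u y0 convex_onD[OF conv, of u _ y] in auto)
    then have "f (u * y) \<le> (1 - u) * f 0 + u * f y"
      by (intro tendsto_le[OF _ R L]) auto
    then show ?thesis using True by simp
  next
    case False
    then show ?thesis using convex_onD[OF conv, of u x y] u x y \<open>x < y\<close> by auto
  qed
qed auto

text \<open>
  Strictness does not survive a limit, so it is taken from inside the interval: to compare
  \<open>f (v * y)\<close> with the chord from \<open>0\<close> to \<open>y\<close>, use the strict inequality for the shorter chord from
  \<open>v * y / 2\<close> to \<open>y\<close>, and the weak one at its left end.
\<close>

lemma strictly_convex_on_include_left_endpoint:
  fixes f :: "real \<Rightarrow> real"
  assumes conv: "convex_on {0..b} f" and strict: "strictly_convex_on {0<..b} f"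
  shows "strictly_convex_on {0..b} f"
proof -
  have zero: "f (v * y) < (1 - v) * f 0 + v * f y" if "0 < v" "v < 1" "0 < y" "y \<le> b" for v y
  proof -
    define w where "w = v / 2"
    define r where "r = (1 - v) / (1 - w)"
    have w: "0 < w" "w < v" "w < 1" using that by (auto simp: w_def)
    have r: "0 < r" "r < 1" using that w by (auto simp: r_def)
    have "r * w + (1 - r) = 1 - r * (1 - w)" by (simp add: algebra_simps)
    then have rw: "r * w + (1 - r) = v" using w by (simp add: r_def)
    have "w * y < 1 * y" using w that by (intro mult_strict_right_mono) auto
    then have wy: "0 < w * y" "w * y < y" using w that by auto
    have "f (v * y) = f (r * (w * y) + (1 - r) * y)"
      unfolding rw[symmetric] by (simp add: algebra_simps)
    also have "\<dots> < r * f (w * y) + (1 - r) * f y"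
      using strict[unfolded strictly_convex_on_def, THEN conjunct2, rule_format,
          of "w * y" y r "1 - r"] that w wy r by simp
    also have "\<dots> \<le> r * ((1 - w) * f 0 + w * f y) + (1 - r) * f y"
      using convex_onD[OF conv, of w 0 y] that w r by (auto intro!: mult_left_mono)
    also have "\<dots> = (1 - v) * f 0 + v * f y"
      unfolding rw[symmetric] by (simp add: algebra_simps)
    finally show ?thesis .
  qed
  show ?thesis
    unfolding strictly_convex_on_def
  proof (intro conjI ballI allI impI)
    fix x y u v :: real
    assume x: "x \<in> {0..b}" and y: "y \<in> {0..b}" and uv: "0 < u" "0 < v" "u + v = 1" and "x \<noteq> y"
    consider "x = 0" "0 < y" | "y = 0" "0 < x" | "0 < x" "0 < y" using x y \<open>x \<noteq> y\<close> by force
    then show "f (u * x + v * y) < u * f x + v * f y"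
    proof cases
      case 1
      then show ?thesis using zero[of v y] y uv by (simp add: eq_diff_eq[symmetric])
    next
      case 2
      then show ?thesis using zero[of u x] x uv by (simp add: eq_diff_eq[symmetric] add.commute)
    next
      case 3
      then show ?thesis using strict x y uv \<open>x \<noteq> y\<close> unfolding strictly_convex_on_def by auto
    qed
  qed auto
qed

lemma strict_antimono_on_if_strictly_convex_on:
  fixes f :: "real \<Rightarrow> real"
  assumes anti: "antimono_on S f" and strict: "strictly_convex_on S f"
    and "s \<in> S" "t \<in> S" "s < t"
  shows "f t < f s"
proof -
  have "convex S" using strict by (simp add: strictly_convex_on_def)
  then have m: "1/2 * s + 1/2 * t \<in> S"
    using convexD[OF \<open>convex S\<close> \<open>s \<in> S\<close> \<open>t \<in> S\<close>, of "1/2" "1/2"] by simp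
  have "f t \<le> f (1/2 * s + 1/2 * t)"
    using m assms by (intro monotone_onD[OF anti]) auto
  also have "\<dots> < 1/2 * f s + 1/2 * f t"
    using strict assms unfolding strictly_convex_on_def
    by (metis add_divide_distrib div_self less_irrefl one_add_one zero_less_divide_1_iff zero_less_numeral zero_neq_numeral)
  finally show ?thesis by simp
qed

text \<open>
  Convexity gives continuity in the interior.  At the right endpoint \<open>f\<close> is squeezed between
  its value there and the chord from \<open>0\<close> to \<open>b\<close>.
\<close>

lemma continuous_on_if_convex_antimono:
  fixes f :: "real \<Rightarrow> real"
  assumes "0 < b" and anti: "antimono_on {0..b} f" and conv: "convex_on {0..b} f"
    and lim: "(f \<longlongrightarrow> f 0) (at_right 0)"
  shows "continuous_on {0..b} f"
  unfolding continuous_on_eq_continuous_within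
proof
  fix t assume t: "t \<in> {0..b}"
  consider "t = 0" | "t = b" | "0 < t" "t < b" using t by force
  then show "continuous (at t within {0..b}) f"
  proof cases
    case 1
    then show ?thesis using \<open>0 < b\<close> lim
      by (simp add: continuous_within at_within_Icc_at_right)
  next
    case 2
    have U: "((\<lambda>t. f b + (b - t) / b * (f 0 - f b)) \<longlongrightarrow> f b) (at_left b)"
      by (rule tendsto_eq_intros refl)+ (use \<open>0 < b\<close> in auto)
    have "\<forall>\<^sub>F s in at_left b. s \<in> {0<..<b}"
      using \<open>0 < b\<close> by (intro eventually_at_left_real) auto
    then have ev: "\<forall>\<^sub>F s in at_left b. f b \<le> f s \<and> f s \<le> f b + (b - s) / b * (f 0 - f b)"
    proof eventually_elim
      case (elim s)
      then have "f s \<le> (1 - s / b) * f 0 + s / b * f b"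
        using convex_onD[OF conv, of "s / b" 0 b] \<open>0 < b\<close> by simp
      also have "\<dots> = f b + (b - s) / b * (f 0 - f b)"
        using \<open>0 < b\<close> by (simp add: field_simps)
      finally show ?case using elim by (auto intro!: monotone_onD[OF anti])
    qed
    have "(f \<longlongrightarrow> f b) (at_left b)"
      by (rule tendsto_sandwich[OF _ _ tendsto_const U]) (use ev in \<open>auto elim: eventually_mono\<close>)
    then show ?thesis using 2 \<open>0 < b\<close>
      by (simp add: continuous_within at_within_Icc_at_left)
  next
    case 3
    have "continuous_on {0<..<b} f"
      by (rule convex_on_continuous[OF open_greaterThanLessThan])
        (rule convex_on_subset[OF conv], auto)
    then have "isCont f t" using 3 by (auto simp: continuous_on_eq_continuous_at)
    then show ?thesis by (rule continuous_at_imp_continuous_within)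
  qed
qed

section \<open>A quadratic minorant\<close>

text \<open>
  The secant line through the two zeros is the horizontal axis, and a convex function lies below a
  secant line between the two points and above it elsewhere.
\<close>

lemma convex_on_two_zeros:
  fixes h :: "real \<Rightarrow> real"
  assumes conv: "convex_on S h" and S: "c \<in> S" "a \<in> S" and "c < a" and zero: "h c = 0" "h a = 0"
    and "t \<in> S"
  shows "t \<le> c \<Longrightarrow> 0 \<le> h t" and "c \<le> t \<Longrightarrow> t \<le> a \<Longrightarrow> h t \<le> 0" and "a \<le> t \<Longrightarrow> 0 \<le> h t"
proof -
  have between: "h y * (z - x) \<le> h x * (z - y) + h z * (y - x)"
    if "x \<in> S" "z \<in> S" "x \<le> y" "y \<le> z" "x < z" for x y z
  proof -
    define u where "u = (y - x) / (z - x)"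
    have u: "0 \<le> u" "u \<le> 1" "u * (z - x) = y - x" using that by (auto simp: u_def)
    have "h y = h ((1 - u) *\<^sub>R x + u *\<^sub>R z)" using u by (simp add: algebra_simps)
    also have "\<dots> \<le> (1 - u) * h x + u * h z" using that u by (intro convex_onD[OF conv]) auto
    finally have "h y * (z - x) \<le> ((1 - u) * h x + u * h z) * (z - x)"
      using that by (intro mult_right_mono) auto
    also have "\<dots> = h x * (z - x - u * (z - x)) + h z * (u * (z - x))" by (simp add: algebra_simps)
    finally show ?thesis using u(3) by simp
  qed
  show "0 \<le> h t" if "t \<le> c"
    using between[of t a c] assms that by (simp add: zero_le_mult_iff)
  show "h t \<le> 0" if "c \<le> t" "t \<le> a"
    using between[of c a t] assms that by (simp add: mult_le_0_iff)
  show "0 \<le> h t" if "a \<le> t"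
    using between[of c t a] assms that by (simp add: zero_le_mult_iff)
qed

text \<open>
  Let \<open>e\<close> be the difference of \<open>f\<close> and the Hermite interpolant with a simple node at \<open>0\<close> and
  a double node at \<open>a\<close>.  By Rolle's theorem \<open>e'\<close> has a zero \<open>c\<close> between the nodes, besides the one
  at \<open>a\<close>.  As \<open>e'\<close> is convex, these zeros determine its sign: \<open>e\<close> increases from \<open>e 0 = 0\<close>
  on \<open>[0, c]\<close>, decreases to \<open>e a = 0\<close> on \<open>[c, a]\<close>, and increases again from there.
\<close>

lemma hermite_quadratic_below:
  fixes f f' :: "real \<Rightarrow> real"
  assumes cont: "continuous_on {0..b} f"
    and der: "\<And>t. 0 < t \<Longrightarrow> t < b \<Longrightarrow> (f has_real_derivative f' t) (at t)"
    and conv: "convex_on {0<..<b} f'"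
    and a: "0 < a" "a < b"
  obtains p q where
    "\<And>t. t \<in> {0..b} \<Longrightarrow> f 0 + p * t + q * t\<^sup>2 \<le> f t"
    "f 0 + p * a + q * a\<^sup>2 = f a"
proof -
  \<comment> \<open>The solution of the interpolation conditions \<open>e a = 0\<close> and \<open>e' a = 0\<close>.\<close>
  define q where "q = (f' a * a - (f a - f 0)) / a\<^sup>2"
  define p where "p = f' a - 2 * q * a"
  have qa: "q * a\<^sup>2 = f' a * a - (f a - f 0)" using a by (simp add: q_def)
  have pa: "f 0 + p * a + q * a\<^sup>2 = f a"
    using qa by (simp add: p_def algebra_simps power2_eq_square)
  define e where "e t = f t - (f 0 + p * t + q * t\<^sup>2)" for t
  define e' where "e' t = f' t + (- p - 2 * q * t)" for t
  have e_der: "(e has_real_derivative e' t) (at t)" if "0 < t" "t < b" for t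
    unfolding e_def[abs_def] e'_def using der[OF that]
    by (auto intro!: derivative_eq_intros simp: algebra_simps)
  have e_cont: "continuous_on {0..b} e"
    unfolding e_def[abs_def] by (intro continuous_intros cont)
  have lin: "convex_on {0<..<b} (\<lambda>t. - p - 2 * q * t)"
    by (rule convex_on_linorderI) (auto simp: algebra_simps)
  have e'_conv: "convex_on {0<..<b} e'"
    unfolding e'_def[abs_def] by (rule convex_on_add[OF conv lin])
  have e0: "e 0 = 0" and ea: "e a = 0" and e'a: "e' a = 0"
    using pa by (simp_all add: e_def e'_def p_def)
  obtain c where c: "0 < c" "c < a" "e' c = 0"
  proof -
    have "\<exists>z>0. z < a \<and> (e has_real_derivative 0) (at z)"
    proof (rule Rolle[OF a(1)])
      show "continuous_on {0..a} e" using e_cont a by (auto intro: continuous_on_subset)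
      show "e differentiable at x" if "0 < x" "x < a" for x
        using e_der[of x] that a by (auto simp: real_differentiable_def)
    qed (use e0 ea in auto)
    then show ?thesis using that e_der a DERIV_unique by (metis less_trans)
  qed
  note zeros = convex_on_two_zeros[OF e'_conv _ _ c(2) c(3) e'a]
  have sub: "continuous_on {s..t} e" if "0 \<le> s" "t \<le> b" for s t
    using e_cont that by (auto intro: continuous_on_subset)
  have "0 \<le> e t" if t: "t \<in> {0..b}" for t
  proof -
    consider "t \<le> c" | "c \<le> t" "t \<le> a" | "a \<le> t" by linarith
    then show ?thesis
    proof cases
      case 1
      have "e 0 \<le> e t"
      proof (rule DERIV_nonneg_imp_increasing_open[where f = e])
        fix x assume "0 < x" "x < t"
        then show "\<exists>y. (e has_real_derivative y) (at x) \<and> 0 \<le> y"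
          using e_der[of x] zeros(1)[of x] a c 1 by force
      qed (use t sub in auto)
      then show ?thesis using e0 by simp
    next
      case 2
      have "e a \<le> e t"
      proof (rule DERIV_nonpos_imp_decreasing_open[where f = e])
        fix x assume "t < x" "x < a"
        then show "\<exists>y. (e has_real_derivative y) (at x) \<and> y \<le> 0"
          using e_der[of x] zeros(2)[of x] a c 2 by force
      qed (use 2 t a sub in auto)
      then show ?thesis using ea by simp
    next
      case 3
      have "e a \<le> e t"
      proof (rule DERIV_nonneg_imp_increasing_open[where f = e])
        fix x assume "a < x" "x < t"
        then show "\<exists>y. (e has_real_derivative y) (at x) \<and> 0 \<le> y"
          using e_der[of x] zeros(3)[of x] a c t 3 by force
      qed (use 3 t a sub in auto)
      then show ?thesis using ea by simp
    qed
  qed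
  then show ?thesis using that pa by (auto simp: e_def)
qed

section \<open>Potentials on the sphere\<close>

lemma norm_diff_sphere:
  fixes x v :: "'a::real_inner"
  assumes "x \<in> sphere 0 1" "v \<in> sphere 0 1"
  shows "(norm (x - v))\<^sup>2 = 2 - 2 * (x \<bullet> v)"
  using assms by (simp add: power2_norm_eq_inner inner_diff norm_eq_1 inner_commute)

lemma potential_on_sphere:
  assumes "x \<in> sphere 0 1" "\<omega> \<subseteq> sphere 0 1"
  shows "potential f \<omega> x = (\<Sum>v\<in>\<omega>. f (2 - 2 * (x \<bullet> v)))"
  unfolding potential_def using assms by (intro sum.cong) (auto simp: norm_diff_sphere)

lemma inner_sphere_bounds:
  fixes x v :: "'a::real_inner"
  assumes "x \<in> sphere 0 1" "v \<in> sphere 0 1"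
  shows "x \<bullet> v \<le> 1" "-1 \<le> x \<bullet> v"
  using Cauchy_Schwarz_ineq2[of x v] assms by auto

text \<open>
  The potential is continuous and the sphere compact, so the set of values has a least element
  and \<open>polarization\<close>, defined by \<open>Least\<close>, is really that minimum.
\<close>

lemma polarization_attained:
  fixes \<omega> :: "(real ^ 'n) set"
  assumes cont: "continuous_on {0..4} f" and \<omega>: "\<omega> \<subseteq> sphere 0 1"
  obtains x where "x \<in> sphere 0 1" "polarization f \<omega> = potential f \<omega> x"
    "\<And>y. y \<in> sphere 0 1 \<Longrightarrow> potential f \<omega> x \<le> potential f \<omega> y"
proof -
  have "continuous_on (sphere 0 1) (potential f \<omega>)"
    unfolding potential_def[abs_def]
  proof (intro continuous_on_sum continuous_on_compose2[OF cont])
    show "(\<lambda>x. (norm (x - v))\<^sup>2) ` sphere 0 1 \<subseteq> {0..4}" if "v \<in> \<omega>" for v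
    proof (rule image_subsetI)
      fix x :: "real ^ 'n" assume x: "x \<in> sphere 0 1"
      have v: "v \<in> sphere 0 1" using that \<omega> by auto
      show "(norm (x - v))\<^sup>2 \<in> {0..4}"
        unfolding norm_diff_sphere[OF x v] using inner_sphere_bounds[OF x v] by simp
    qed
  qed (intro continuous_intros)
  moreover have "sphere (0 :: real ^ 'n) 1 \<noteq> {}" by simp
  ultimately obtain x where x: "x \<in> sphere 0 1"
    "\<And>y. y \<in> sphere 0 1 \<Longrightarrow> potential f \<omega> x \<le> potential f \<omega> y"
    using continuous_attains_inf[of "sphere (0 :: real ^ 'n) 1" "potential f \<omega>"] by auto
  then have "polarization f \<omega> = potential f \<omega> x"
    unfolding polarization_def by (intro Least_equality) auto
  with x show ?thesis using that by blast
qed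

lemma polarization_le_potential:
  fixes \<omega> :: "(real ^ 'n) set"
  assumes "continuous_on {0..4} f" "\<omega> \<subseteq> sphere 0 1" "x \<in> sphere 0 1"
  shows "polarization f \<omega> \<le> potential f \<omega> x"
  using assms by (metis polarization_attained)


section \<open>Regular simplices\<close>

lemma inner_sum_equiangular:
  fixes \<omega> :: "'a::real_inner set"
  assumes "finite \<omega>" "\<omega> \<subseteq> sphere 0 1"
    and "\<And>u v. u \<in> \<omega> \<Longrightarrow> v \<in> \<omega> \<Longrightarrow> u \<noteq> v \<Longrightarrow> u \<bullet> v = a" and "k \<in> \<omega>"
  shows "(\<Sum>v\<in>\<omega>. \<mu> v *\<^sub>R v) \<bullet> k = a * sum \<mu> \<omega> + (1 - a) * \<mu> k"
proof -
  have "(\<Sum>v\<in>\<omega>. \<mu> v *\<^sub>R v) \<bullet> k = (\<Sum>v\<in>\<omega>. a * \<mu> v + (if v = k then (1 - a) * \<mu> v else 0))"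
    unfolding inner_sum_left
  proof (rule sum.cong[OF refl])
    fix v assume "v \<in> \<omega>"
    moreover have "k \<bullet> k = 1" using assms by (auto simp: norm_eq_1)
    ultimately show "\<mu> v *\<^sub>R v \<bullet> k = a * \<mu> v + (if v = k then (1 - a) * \<mu> v else 0)"
      using assms(3)[of v k] \<open>k \<in> \<omega>\<close> by (auto simp: algebra_simps)
  qed
  also have "\<dots> = a * sum \<mu> \<omega> + (1 - a) * \<mu> k"
    using assms by (simp add: sum.distrib sum_distrib_left)
  finally show ?thesis .
qed

text \<open>
  Let \<open>a\<close> be the common inner product.  Taking inner products of a linear relation with the
  vertices shows that its coefficients are all equal.  A nontrivial relation exists, since there are
  more vertices than dimensions; hence the vertices sum to zero, and the inner product
  of this sum with a vertex gives \<open>a = - 1 / d\<close>.  The same observation makes any \<open>d\<close> vertices independent, hence spanning, and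
  expanding \<open>x\<close> in the vertices yields the frame identity.
\<close>

lemma regular_simplex_frame:
  fixes \<omega> :: "(real ^ 'n) set"
  assumes reg: "regular_simplex_vertices \<omega>"
  shows "\<And>u v. u \<in> \<omega> \<Longrightarrow> v \<in> \<omega> \<Longrightarrow> u \<noteq> v \<Longrightarrow> u \<bullet> v = - 1 / real CARD('n)"
    and "\<Sum>\<omega> = 0"
    and "(\<Sum>v\<in>\<omega>. (x \<bullet> v)\<^sup>2) = (1 + 1 / real CARD('n)) * (x \<bullet> x)"
proof -
  define d where "d = real CARD('n)"
  have d: "d > 0" by (simp add: d_def)
  have \<omega>: "\<omega> \<subseteq> sphere 0 1" and card: "card \<omega> = CARD('n) + 1"
    using reg by (auto simp: regular_simplex_vertices_def simplex_configuration_def)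
  have fin: "finite \<omega>" using card card.infinite by fastforce
  obtain c where c: "\<And>u v. u \<in> \<omega> \<Longrightarrow> v \<in> \<omega> \<Longrightarrow> u \<noteq> v \<Longrightarrow> dist u v = c"
    using reg by (auto simp: regular_simplex_vertices_def)
  define a where "a = 1 - c\<^sup>2 / 2"
  have a: "u \<bullet> v = a" if "u \<in> \<omega>" "v \<in> \<omega>" "u \<noteq> v" for u v
  proof -
    have "u \<in> sphere 0 1" "v \<in> sphere 0 1" using that \<omega> by auto
    from norm_diff_sphere[OF this] show ?thesis
      using c[OF that] by (simp add: a_def dist_norm diff_divide_distrib)
  qed
  have "a \<noteq> 1"
  proof -
    have "\<exists>u\<in>\<omega>. \<exists>v\<in>\<omega>. u \<noteq> v"
    proof (rule ccontr)
      assume "\<not> ?thesis"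
      then have "card \<omega> \<le> 1" using card_le_Suc0_iff_eq[OF fin] by auto
      then show False using card by simp
    qed
    then have "c \<noteq> 0" using c by force
    then show ?thesis by (simp add: a_def)
  qed
  note expand = inner_sum_equiangular[OF fin \<omega> a]
  have const: "\<mu> k = - a * sum \<mu> \<omega> / (1 - a)" if "(\<Sum>v\<in>\<omega>. \<mu> v *\<^sub>R v) = 0" "k \<in> \<omega>" for \<mu> k
    using expand[of k \<mu>] that \<open>a \<noteq> 1\<close> by (simp add: field_simps)
  have "dependent \<omega>" by (rule dependent_biggerset) (use card in simp)
  then obtain \<mu> w where \<mu>: "(\<Sum>v\<in>\<omega>. \<mu> v *\<^sub>R v) = 0" and w: "w \<in> \<omega>" "\<mu> w \<noteq> 0"
    using dependent_finite[OF fin] by auto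
  define m where "m = - a * sum \<mu> \<omega> / (1 - a)"
  have m: "\<mu> k = m" if "k \<in> \<omega>" for k using const[OF \<mu> that] by (simp add: m_def)
  then have "m \<noteq> 0" using w by auto
  have "sum \<mu> \<omega> = (d + 1) * m" using m card by (simp add: d_def)
  moreover have "m * (1 - a) = - a * sum \<mu> \<omega>" using \<open>a \<noteq> 1\<close> by (simp add: m_def)
  ultimately have "m * (1 - a) = - a * ((d + 1) * m)" by simp
  then have "m * (1 + a * d) = 0" by (simp add: algebra_simps)
  then have "1 + a * d = 0" using \<open>m \<noteq> 0\<close> mult_eq_0_iff by blast
  then have ad: "a = - 1 / d" using d by (simp add: field_simps)
  show "u \<bullet> v = - 1 / real CARD('n)" if "u \<in> \<omega>" "v \<in> \<omega>" "u \<noteq> v" for u v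
    using a[OF that] ad by (simp add: d_def)
  have "m *\<^sub>R \<Sum>\<omega> = 0" using \<mu> m by (simp add: scaleR_sum_right)
  then show S: "\<Sum>\<omega> = 0" using \<open>m \<noteq> 0\<close> by simp
  have "independent (\<omega> - {w})"
  proof
    assume "dependent (\<omega> - {w})"
    then obtain \<nu> y where \<nu>: "(\<Sum>v\<in>\<omega> - {w}. \<nu> v *\<^sub>R v) = 0" and y: "y \<in> \<omega> - {w}" "\<nu> y \<noteq> 0"
      using dependent_finite[of "\<omega> - {w}"] fin by auto
    define \<nu>' where "\<nu>' = \<nu>(w := 0)"
    have "(\<Sum>v\<in>\<omega>. \<nu>' v *\<^sub>R v) = (\<Sum>v\<in>\<omega> - {w}. \<nu> v *\<^sub>R v)"
      using fin w(1) by (simp add: sum.remove[of _ w] \<nu>'_def)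
    then have rel: "(\<Sum>v\<in>\<omega>. \<nu>' v *\<^sub>R v) = 0" using \<nu> by simp
    have "\<nu>' y = \<nu>' w" using const[OF rel w(1)] const[OF rel, of y] y by (metis DiffD1)
    then show False using y by (simp add: \<nu>'_def)
  qed
  then have "UNIV \<subseteq> span (\<omega> - {w})"
    by (rule card_ge_dim_independent[OF subset_UNIV]) (use card fin w in \<open>simp add: dim_UNIV\<close>)
  then have "x \<in> span \<omega>" using span_mono[of "\<omega> - {w}" \<omega>] by auto
  then obtain \<gamma> where \<gamma>: "x = (\<Sum>v\<in>\<omega>. \<gamma> v *\<^sub>R v)" using span_finite[OF fin] by auto
  have "(\<Sum>v\<in>\<omega>. (x \<bullet> v)\<^sup>2) = (\<Sum>v\<in>\<omega>. (a * sum \<gamma> \<omega>) * (x \<bullet> v) + (1 - a) * (\<gamma> v * (x \<bullet> v)))"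
  proof (rule sum.cong[OF refl])
    fix v assume "v \<in> \<omega>"
    then have "x \<bullet> v = a * sum \<gamma> \<omega> + (1 - a) * \<gamma> v" using expand[of v \<gamma>] by (simp add: \<gamma>)
    then have "(x \<bullet> v) * (x \<bullet> v) = (a * sum \<gamma> \<omega> + (1 - a) * \<gamma> v) * (x \<bullet> v)" by simp
    then show "(x \<bullet> v)\<^sup>2 = (a * sum \<gamma> \<omega>) * (x \<bullet> v) + (1 - a) * (\<gamma> v * (x \<bullet> v))"
      by (simp add: power2_eq_square distrib_right mult.assoc)
  qed
  also have "\<dots> = (a * sum \<gamma> \<omega>) * (x \<bullet> \<Sum>\<omega>) + (1 - a) * (x \<bullet> (\<Sum>v\<in>\<omega>. \<gamma> v *\<^sub>R v))"
    by (simp add: sum.distrib sum_distrib_left inner_sum_right)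
  also have "\<dots> = (1 + 1 / d) * (x \<bullet> x)"
    unfolding \<gamma>[symmetric] S ad by simp
  finally show "(\<Sum>v\<in>\<omega>. (x \<bullet> v)\<^sup>2) = (1 + 1 / real CARD('n)) * (x \<bullet> x)"
    by (simp add: d_def)
qed

text \<open>
  The dimension must be at least \<open>2\<close> in order that the node \<open>2 + 2 / d\<close> of the interpolation lie in
  the open interval where \<open>f\<close> is differentiable.
\<close>

lemma polarization_regular_simplex:
  fixes \<omega> :: "(real ^ 'n) set" and f f' :: "real \<Rightarrow> real"
  assumes card: "CARD('n) \<ge> 2"
    and cont: "continuous_on {0..4} f"
    and der: "\<And>t. 0 < t \<Longrightarrow> t < 4 \<Longrightarrow> (f has_real_derivative f' t) (at t)"
    and conv: "convex_on {0<..<4} f'"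
    and reg: "regular_simplex_vertices \<omega>"
  shows "polarization f \<omega> = f 0 + real CARD('n) * f (2 + 2 / real CARD('n))"
proof -
  define d where "d = real CARD('n)"
  define a where "a = 2 + 2 / d"
  have d: "d \<ge> 2" using card by (simp add: d_def)
  have a: "0 < a" "a < 4" using d by (auto simp: a_def field_simps)
  have \<omega>: "\<omega> \<subseteq> sphere 0 1" and card: "card \<omega> = CARD('n) + 1"
    using reg by (auto simp: regular_simplex_vertices_def simplex_configuration_def)
  have fin: "finite \<omega>" using card card.infinite by fastforce
  note frame = regular_simplex_frame[OF reg]
  have lower: "f 0 + d * f a \<le> potential f \<omega> x" if x: "x \<in> sphere 0 1" for x
  proof -
    obtain p q where pq: "\<And>t. t \<in> {0..4} \<Longrightarrow> f 0 + p * t + q * t\<^sup>2 \<le> f t"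
      and fa: "f 0 + p * a + q * a\<^sup>2 = f a"
      using hermite_quadratic_below[OF cont der conv a] by metis
    have S1: "(\<Sum>v\<in>\<omega>. x \<bullet> v) = 0" using frame(2) by (simp add: inner_sum_right[symmetric])
    have S2: "(\<Sum>v\<in>\<omega>. (x \<bullet> v)\<^sup>2) = 1 + 1 / d"
      using frame(3)[of x] x by (simp add: d_def norm_eq_1)
    have cd: "real (card \<omega>) = d + 1" using card by (simp add: d_def)
    \<comment> \<open>The potential of the quadratic minorant is the same at a vertex and at \<open>x\<close>.\<close>
    have "f 0 + d * f a = (d + 1) * f 0 + p * (d * a) + q * (d * a\<^sup>2)"
      unfolding fa[symmetric] by (simp add: algebra_simps)
    also have "\<dots> = (f 0 + 2 * p + 4 * q) * (d + 1) + 4 * q * (1 + 1 / d)"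
      using d by (simp add: a_def field_simps power2_eq_square)
    also have "\<dots> = (\<Sum>v\<in>\<omega>. (f 0 + 2 * p + 4 * q) - (2 * p + 8 * q) * (x \<bullet> v) + 4 * q * (x \<bullet> v)\<^sup>2)"
      by (simp add: sum.distrib sum_subtractf sum_distrib_left[symmetric] S1 S2 cd)
    also have "\<dots> = (\<Sum>v\<in>\<omega>. f 0 + p * (2 - 2 * (x \<bullet> v)) + q * (2 - 2 * (x \<bullet> v))\<^sup>2)"
      by (intro sum.cong) (auto simp: algebra_simps power2_eq_square)
    also have "\<dots> \<le> (\<Sum>v\<in>\<omega>. f (2 - 2 * (x \<bullet> v)))"
    proof (intro sum_mono pq)
      fix v assume "v \<in> \<omega>"
      then show "2 - 2 * (x \<bullet> v) \<in> {0..4}" using inner_sphere_bounds[OF x, of v] \<omega> by auto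
    qed
    finally show ?thesis using potential_on_sphere[OF x \<omega>] by simp
  qed
  obtain w where w: "w \<in> \<omega>" using card by fastforce
  then have ws: "w \<in> sphere 0 1" using \<omega> by auto
  have "potential f \<omega> w = f (2 - 2 * (w \<bullet> w)) + (\<Sum>v\<in>\<omega> - {w}. f (2 - 2 * (w \<bullet> v)))"
    using potential_on_sphere[OF ws \<omega>] sum.remove[OF fin w] by simp
  also have "(\<Sum>v\<in>\<omega> - {w}. f (2 - 2 * (w \<bullet> v))) = (\<Sum>v\<in>\<omega> - {w}. f a)"
    using frame(1)[OF w] by (intro sum.cong) (auto simp: a_def d_def)
  also have "\<dots> = d * f a" using card w fin by (simp add: d_def)
  finally have "potential f \<omega> w = f 0 + d * f a" using ws by (simp add: norm_eq_1)
  then show ?thesis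
    using polarization_attained[OF cont \<omega>] polarization_le_potential[OF cont \<omega> ws] lower
    by (metis a_def antisym d_def)
qed

section \<open>Arbitrary configurations\<close>

text \<open>
  If \<open>h \<ge> 1 / d\<close>, monotonicity suffices for each term.  Otherwise \<open>s\<close> may be replaced by the smaller
  of its bounds, \<open>d * h < 1\<close>.  The arguments \<open>2 - 2 * d * h\<close> (once) and \<open>2 + 2 * h\<close>
  (\<open>d\<close> times) then have the same sum as \<open>0\<close> (once) and \<open>2 + 2 / d\<close> (\<open>d\<close> times), and lie between
  these two, so that estimating each value of \<open>f\<close> by the chord gives the claim.
\<close>

lemma two_value_bound:
  fixes f :: "real \<Rightarrow> real"
  assumes anti: "antimono_on {0..4} f" and conv: "convex_on {0..4} f"
    and d: "1 \<le> d" and s: "-1 \<le> s" "s \<le> 1" and h: "0 \<le> h" "h \<le> 1" and sh: "s \<le> d * h"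
  shows "f (2 - 2 * s) + d * f (2 + 2 * h) \<le> f 0 + d * f (2 + 2 / d)"
    and "strictly_convex_on {0..4} f \<Longrightarrow>
      f (2 - 2 * s) + d * f (2 + 2 * h) = f 0 + d * f (2 + 2 / d) \<Longrightarrow> s = 1 \<and> h = 1 / d"
proof -
  define a where "a = 2 + 2 / d"
  have a: "0 < a" "a \<le> 4" "d * a = 2 * d + 2" using d by (auto simp: a_def field_simps)
  have "f (2 - 2 * s) + d * f (2 + 2 * h) \<le> f 0 + d * f a \<and>
    (strictly_convex_on {0..4} f \<longrightarrow>
      f (2 - 2 * s) + d * f (2 + 2 * h) = f 0 + d * f a \<longrightarrow> s = 1 \<and> h = 1 / d)"
  proof (cases "1 / d \<le> h")
    case True
    then have ah: "a \<le> 2 + 2 * h" by (simp add: a_def)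
    have 1: "f (2 - 2 * s) \<le> f 0" using s by (intro monotone_onD[OF anti]) auto
    have 2: "f (2 + 2 * h) \<le> f a" using a h ah by (intro monotone_onD[OF anti]) auto
    then have 3: "d * f (2 + 2 * h) \<le> d * f a" using d by simp
    have "s = 1 \<and> h = 1 / d" if str: "strictly_convex_on {0..4} f"
      and eq: "f (2 - 2 * s) + d * f (2 + 2 * h) = f 0 + d * f a"
    proof -
      note less = strict_antimono_on_if_strictly_convex_on[OF anti str]
      have "f (2 - 2 * s) = f 0" "d * f (2 + 2 * h) = d * f a" using 1 3 eq by linarith+
      then have "\<not> 0 < 2 - 2 * s" "\<not> a < 2 + 2 * h"
        using less[of 0 "2 - 2 * s"] less[of a "2 + 2 * h"] s h a d by force+
      then show ?thesis using True s by (simp add: a_def)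
    qed
    then show ?thesis using 1 3 by auto
  next
    case False
    then have dh: "d * h < 1" using d by (simp add: field_simps)
    \<comment> \<open>Positions of the two arguments relative to the interval from \<open>0\<close> to \<open>a\<close>.\<close>
    define \<theta> \<phi> where "\<theta> = (2 + 2 * h) / a" and "\<phi> = (2 - 2 * (d * h)) / a"
    have "2 + 2 * h < a" using False by (simp add: a_def)
    then have \<theta>: "0 < \<theta>" "\<theta> < 1" "\<theta> * a = 2 + 2 * h" using a h by (auto simp: \<theta>_def)
    have "0 \<le> d * h" using d h by simp
    moreover have "2 \<le> a" using d by (simp add: a_def)
    ultimately have \<phi>: "0 \<le> \<phi>" "\<phi> \<le> 1" "\<phi> * a = 2 - 2 * (d * h)"
      using a dh by (auto simp: \<phi>_def)
    have "(\<phi> + d * \<theta>) * a = \<phi> * a + d * (\<theta> * a)" by (simp add: algebra_simps)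
    also have "\<dots> = d * a" unfolding \<theta>(3) \<phi>(3) a(3) by (simp add: algebra_simps)
    finally have "(\<phi> + d * \<theta>) * a = d * a" .
    then have sum: "\<phi> + d * \<theta> = d" using a(1) mult_right_cancel[of a] by blast
    have "f (2 - 2 * s) \<le> f (2 - 2 * (d * h))"
      using s sh dh by (intro monotone_onD[OF anti]) auto
    also have "\<dots> \<le> (1 - \<phi>) * f 0 + \<phi> * f a"
      using convex_onD[OF conv \<phi>(1,2), of 0 a] a \<phi>(3) by simp
    finally have 1: "f (2 - 2 * s) \<le> (1 - \<phi>) * f 0 + \<phi> * f a" .
    have "f (2 + 2 * h) \<le> (1 - \<theta>) * f 0 + \<theta> * f a"
      using convex_onD[OF conv, of \<theta> 0 a] a \<theta> by simp
    then have 2: "d * f (2 + 2 * h) \<le> d * ((1 - \<theta>) * f 0 + \<theta> * f a)" using d by simp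
    have "(1 - \<phi>) * f 0 + \<phi> * f a + d * ((1 - \<theta>) * f 0 + \<theta> * f a)
        = (1 + d - (\<phi> + d * \<theta>)) * f 0 + (\<phi> + d * \<theta>) * f a"
      by (simp add: algebra_simps)
    then have 3: "(1 - \<phi>) * f 0 + \<phi> * f a + d * ((1 - \<theta>) * f 0 + \<theta> * f a) = f 0 + d * f a"
      by (simp add: sum)
    have "d * f (2 + 2 * h) < d * ((1 - \<theta>) * f 0 + \<theta> * f a)" if "strictly_convex_on {0..4} f"
    proof -
      have "f ((1 - \<theta>) * 0 + \<theta> * a) < (1 - \<theta>) * f 0 + \<theta> * f a"
        using that[unfolded strictly_convex_on_def, THEN conjunct2, rule_format,
            of 0 a "1 - \<theta>" \<theta>] a \<theta> by simp
      then show ?thesis using \<theta>(3) d by simp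
    qed
    then show ?thesis using 1 2 3 by fastforce
  qed
  then show "f (2 - 2 * s) + d * f (2 + 2 * h) \<le> f 0 + d * f (2 + 2 / d)"
    "strictly_convex_on {0..4} f \<Longrightarrow>
      f (2 - 2 * s) + d * f (2 + 2 * h) = f 0 + d * f (2 + 2 / d) \<Longrightarrow> s = 1 \<and> h = 1 / d"
    by (auto simp: a_def)
qed

text \<open>
  The conditions that \<open>x\<close> have the same inner product with all the \<open>d\<close> points amount to only
  \<open>d - 1\<close> homogeneous linear equations, so they have a nonzero solution, and its sign is free.
\<close>

lemma facet_normal:
  fixes B :: "(real ^ 'n) set"
  assumes "finite B" "card B = CARD('n)"
  obtains x h where "x \<in> sphere 0 1" "0 \<le> h" "\<And>v. v \<in> B \<Longrightarrow> x \<bullet> v = - h"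
proof -
  have "B \<noteq> {}" using assms by auto
  then obtain k where k: "k \<in> B" by auto
  define D where "D = (\<lambda>v. v - k) ` (B - {k})"
  have "card (B - {k}) < CARD('n)" using assms k by (simp add: card_gt_0_iff)
  then have "card D < CARD('n)"
    using card_image_le[of "B - {k}" "\<lambda>v. v - k"] assms by (simp add: D_def)
  then have "dim D < DIM(real ^ 'n)"
    using dim_le_card'[of D] assms by (simp add: D_def)
  then obtain y where y: "y \<noteq> 0" "\<And>z. z \<in> span D \<Longrightarrow> orthogonal y z"
    using orthogonal_to_subspace_exists by blast
  have eq: "y \<bullet> v = y \<bullet> k" if "v \<in> B" for v
  proof (cases "v = k")
    case False
    then have "v - k \<in> span D" using that by (auto simp: D_def intro: span_base)
    from y(2)[OF this] show ?thesis by (simp add: orthogonal_def inner_diff_right)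
  qed simp
  define c where "c = (if y \<bullet> k \<le> 0 then 1 else -1) / norm y"
  show ?thesis
  proof (rule that[of "c *\<^sub>R y" "- (c * (y \<bullet> k))"])
    show "c *\<^sub>R y \<in> sphere 0 1" using y(1) by (simp add: c_def)
    show "0 \<le> - (c * (y \<bullet> k))" using y(1) by (simp add: c_def divide_le_0_iff)
    show "c *\<^sub>R y \<bullet> v = - (- (c * (y \<bullet> k)))" if "v \<in> B" for v
      using eq[OF that] by simp
  qed
qed

text \<open>
  Evaluate the potential at the unit normal \<open>x\<close> of the hyperplane through the points other than \<open>w\<close>,
  with \<open>x \<bullet> v = - h \<le> 0\<close> for these points and \<open>s = x \<bullet> w\<close>.  The weight of \<open>w\<close> enters
  through the identity \<open>\<mu> w * s = (1 - \<mu> w) * h\<close>: a weight at least the average \<open>1 / (d + 1)\<close>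
  means that \<open>s \<le> d * h\<close>, and in the extremal case \<open>s = 1\<close>, \<open>h = 1 / d\<close> it is the average.
\<close>

lemma polarization_le_at_heavy_vertex:
  fixes \<omega> :: "(real ^ 'n) set"
  assumes card: "CARD('n) \<ge> 2" and anti: "antimono_on {0..4} f" and conv: "convex_on {0..4} f"
    and cont: "continuous_on {0..4} f" and conf: "simplex_configuration \<omega>"
    and \<mu>: "sum \<mu> \<omega> = 1" "(\<Sum>v\<in>\<omega>. \<mu> v *\<^sub>R v) = 0"
    and w: "w \<in> \<omega>" "1 / (real CARD('n) + 1) \<le> \<mu> w"
  shows "polarization f \<omega> \<le> f 0 + real CARD('n) * f (2 + 2 / real CARD('n))"
    and "strictly_convex_on {0..4} f \<Longrightarrow>
      polarization f \<omega> = f 0 + real CARD('n) * f (2 + 2 / real CARD('n)) \<Longrightarrow>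
      \<mu> w = 1 / (real CARD('n) + 1) \<and> (\<forall>v\<in>\<omega> - {w}. w \<bullet> v = - 1 / real CARD('n))"
proof -
  define d where "d = real CARD('n)"
  have d: "d \<ge> 2" using card by (simp add: d_def)
  have \<omega>: "\<omega> \<subseteq> sphere 0 1" and card\<omega>: "card \<omega> = CARD('n) + 1"
    using conf by (auto simp: simplex_configuration_def)
  have fin: "finite \<omega>" using card\<omega> card.infinite by fastforce
  obtain x h where x: "x \<in> sphere 0 1" and h: "0 \<le> h"
    and xh: "\<And>v. v \<in> \<omega> - {w} \<Longrightarrow> x \<bullet> v = - h"
    using facet_normal[of "\<omega> - {w}"] fin w card\<omega> by auto
  define s where "s = x \<bullet> w"
  have s: "-1 \<le> s" "s \<le> 1" using inner_sphere_bounds[OF x, of w] w \<omega> by (auto simp: s_def)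
  have "\<omega> - {w} \<noteq> {}" using card\<omega> fin w card_Diff_singleton[of w \<omega>] by fastforce
  then obtain u where u: "u \<in> \<omega> - {w}" by auto
  have "h \<le> 1" using inner_sphere_bounds[OF x, of u] u \<omega> xh[OF u] by auto
  have "0 = (\<Sum>v\<in>\<omega>. \<mu> v * (x \<bullet> v))"
    using arg_cong[OF \<mu>(2), of "inner x"] by (simp add: inner_sum_right)
  also have "\<dots> = \<mu> w * s + (\<Sum>v\<in>\<omega> - {w}. \<mu> v * (- h))"
    using fin w xh by (simp add: sum.remove[of _ w] s_def)
  also have "(\<Sum>v\<in>\<omega> - {w}. \<mu> v * (- h)) = - (1 - \<mu> w) * h"
  proof -
    have "sum \<mu> (\<omega> - {w}) = 1 - \<mu> w" using \<mu>(1) fin w by (simp add: sum.remove[of _ w])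
    then show ?thesis by (simp only: sum_distrib_right[symmetric])
  qed
  finally have bal: "\<mu> w * s = (1 - \<mu> w) * h" by (simp add: algebra_simps)
  have "0 < 1 / (d + 1)" using d by simp
  then have "0 < \<mu> w" using w(2) unfolding d_def by (rule less_le_trans)
  moreover have "1 \<le> (d + 1) * \<mu> w" using w(2) d by (simp add: d_def field_simps)
  ultimately have lw: "0 < \<mu> w" "1 \<le> (d + 1) * \<mu> w" .
  then have "\<mu> w * s \<le> \<mu> w * (d * h)"
    unfolding bal using mult_right_mono[of "1 - \<mu> w" "d * \<mu> w" h] h by (simp add: algebra_simps)
  then have sh: "s \<le> d * h" using lw by simp
  have "potential f \<omega> x = f (2 - 2 * s) + (\<Sum>v\<in>\<omega> - {w}. f (2 + 2 * h))"
    using potential_on_sphere[OF x \<omega>] fin w xh by (simp add: sum.remove[of _ w] s_def)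
  then have pot: "potential f \<omega> x = f (2 - 2 * s) + d * f (2 + 2 * h)"
    using fin w card\<omega> by (simp add: d_def)
  note bound = two_value_bound[OF anti conv _ s h \<open>h \<le> 1\<close> sh]
  have le: "polarization f \<omega> \<le> potential f \<omega> x"
    by (rule polarization_le_potential[OF cont \<omega> x])
  then show "polarization f \<omega> \<le> f 0 + real CARD('n) * f (2 + 2 / real CARD('n))"
    using bound(1) pot d by (simp add: d_def)
  show "\<mu> w = 1 / (real CARD('n) + 1) \<and> (\<forall>v\<in>\<omega> - {w}. w \<bullet> v = - 1 / real CARD('n))"
    if str: "strictly_convex_on {0..4} f"
      and eq: "polarization f \<omega> = f 0 + real CARD('n) * f (2 + 2 / real CARD('n))"
  proof -
    have "f (2 - 2 * s) + d * f (2 + 2 * h) = f 0 + d * f (2 + 2 / d)"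
      using eq le bound(1) d pot by (simp add: d_def)
    then have sh1: "s = 1" "h = 1 / d" using bound(2) str d by auto
    \<comment> \<open>Two unit vectors with inner product \<open>1\<close> coincide.\<close>
    have "(norm (x - w))\<^sup>2 = 0" using norm_diff_sphere[OF x, of w] w \<omega> sh1 by (auto simp: s_def)
    then have "x = w" by simp
    moreover have "\<mu> w = 1 / (d + 1)" using bal d by (simp add: sh1 field_simps)
    ultimately show ?thesis using xh sh1 by (simp add: d_def)
  qed
qed

lemma nonpositive_inner_if_zero_notin_hull:
  fixes \<omega> :: "(real ^ 'n) set"
  assumes "finite \<omega>" "0 \<notin> convex hull \<omega>"
  obtains x where "x \<in> sphere 0 1" "\<And>v. v \<in> \<omega> \<Longrightarrow> x \<bullet> v \<le> 0"
proof -
  have "closed (convex hull \<omega>)"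
    using assms by (intro compact_imp_closed finite_imp_compact_convex_hull)
  then obtain a b where a: "a \<noteq> 0" "0 < b" "\<And>v. v \<in> convex hull \<omega> \<Longrightarrow> b < a \<bullet> v"
    using separating_hyperplane_closed_0[OF convex_convex_hull _ assms(2)] by metis
  have "0 < a \<bullet> v" if "v \<in> \<omega>" for v using a(2) a(3)[OF hull_inc[OF that]] by simp
  then have "(- (1 / norm a)) *\<^sub>R a \<bullet> v \<le> 0" if "v \<in> \<omega>" for v
    using that by (simp add: less_imp_le)
  then show ?thesis using that[of "(- (1 / norm a)) *\<^sub>R a"] a(1) by simp
qed

text \<open>
  In the equality case every point of at least average weight has exactly average weight.  Hence all
  weights are average, and each point may take the role of the heavy vertex.
\<close>

lemma polarization_simplex_configuration:
  fixes \<omega> :: "(real ^ 'n) set"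
  assumes card: "CARD('n) \<ge> 2" and anti: "antimono_on {0..4} f" and conv: "convex_on {0..4} f"
    and cont: "continuous_on {0..4} f" and conf: "simplex_configuration \<omega>"
  shows "polarization f \<omega> \<le> f 0 + real CARD('n) * f (2 + 2 / real CARD('n))"
    and "strictly_convex_on {0..4} f \<Longrightarrow>
      polarization f \<omega> = f 0 + real CARD('n) * f (2 + 2 / real CARD('n)) \<Longrightarrow>
      regular_simplex_vertices \<omega>"
proof -
  define d where "d = real CARD('n)"
  define V where "V = f 0 + d * f (2 + 2 / d)"
  have d: "d \<ge> 2" using card by (simp add: d_def)
  have \<omega>: "\<omega> \<subseteq> sphere 0 1" and card\<omega>: "card \<omega> = CARD('n) + 1"
    using conf by (auto simp: simplex_configuration_def)
  have fin: "finite \<omega>" using card\<omega> card.infinite by fastforce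
  have "polarization f \<omega> \<le> V \<and>
    (strictly_convex_on {0..4} f \<longrightarrow> polarization f \<omega> = V \<longrightarrow> regular_simplex_vertices \<omega>)"
  proof (cases "0 \<in> convex hull \<omega>")
    case False
    then obtain x where x: "x \<in> sphere 0 1" and neg: "\<And>v. v \<in> \<omega> \<Longrightarrow> x \<bullet> v \<le> 0"
      using nonpositive_inner_if_zero_notin_hull[OF fin] by blast
    have "polarization f \<omega> \<le> potential f \<omega> x"
      by (rule polarization_le_potential[OF cont \<omega> x])
    also have "\<dots> = (\<Sum>v\<in>\<omega>. f (2 - 2 * (x \<bullet> v)))" by (rule potential_on_sphere[OF x \<omega>])
    also have "\<dots> \<le> (\<Sum>v\<in>\<omega>. f 2)"
    proof (rule sum_mono)
      fix v assume "v \<in> \<omega>"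
      then show "f (2 - 2 * (x \<bullet> v)) \<le> f 2"
        using neg[of v] inner_sphere_bounds[OF x, of v] \<omega> by (intro monotone_onD[OF anti]) auto
    qed
    also have "\<dots> = f 2 + d * f 2" using card\<omega> by (simp add: d_def algebra_simps)
    finally have le: "polarization f \<omega> \<le> f 2 + d * f 2" .
    \<comment> \<open>The degenerate case \<open>s = h = 0\<close> of the two-value bound.\<close>
    have "f 2 + d * f 2 \<le> V"
      using two_value_bound(1)[OF anti conv, of d 0 0] d by (simp add: V_def)
    moreover have "f 2 + d * f 2 \<noteq> V" if "strictly_convex_on {0..4} f"
      using two_value_bound(2)[OF anti conv, of d 0 0] that d by (auto simp: V_def)
    ultimately show ?thesis using le by force
  next
    case True
    then obtain \<mu> where \<mu>: "sum \<mu> \<omega> = 1" "(\<Sum>v\<in>\<omega>. \<mu> v *\<^sub>R v) = 0"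
      unfolding convex_hull_finite[OF fin] by auto
    note heavy = polarization_le_at_heavy_vertex[OF card anti conv cont conf \<mu>, folded d_def, folded V_def]
    have avg: "(\<Sum>v\<in>\<omega>. 1 / (d + 1)) = 1" using card\<omega> d by (simp add: d_def)
    have "\<exists>w\<in>\<omega>. 1 / (d + 1) \<le> \<mu> w"
    proof (rule ccontr)
      assume "\<not> ?thesis"
      then have "sum \<mu> \<omega> < (\<Sum>v\<in>\<omega>. 1 / (d + 1))"
        using fin card\<omega> by (intro sum_strict_mono) auto
      then show False using avg \<mu>(1) by simp
    qed
    then have "polarization f \<omega> \<le> V" using heavy(1) by blast
    moreover have "regular_simplex_vertices \<omega>"
      if str: "strictly_convex_on {0..4} f" and eq: "polarization f \<omega> = V"
    proof -
      have le: "\<mu> v \<le> 1 / (d + 1)" if "v \<in> \<omega>" for v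
        using heavy(2)[OF that _ str eq] by fastforce
      have ge: "1 / (d + 1) \<le> \<mu> v" if "v \<in> \<omega>" for v
      proof (rule ccontr)
        assume "\<not> ?thesis"
        then have "sum \<mu> \<omega> < (\<Sum>v\<in>\<omega>. 1 / (d + 1))"
          using fin le that by (intro sum_strict_mono_ex1) (auto simp: not_le)
        then show False using avg \<mu>(1) by simp
      qed
      have "dist u v = sqrt (2 + 2 / d)" if "u \<in> \<omega>" "v \<in> \<omega>" "u \<noteq> v" for u v
      proof -
        have "u \<bullet> v = - 1 / d" using heavy(2)[OF that(1) ge str eq] that by auto
        then have "(norm (u - v))\<^sup>2 = 2 + 2 / d" using norm_diff_sphere[of u v] that \<omega> by force
        then show ?thesis by (metis dist_norm norm_ge_zero real_sqrt_unique)
      qed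
      then show ?thesis using conf by (auto simp: regular_simplex_vertices_def)
    qed
    ultimately show ?thesis by blast
  qed
  then show "polarization f \<omega> \<le> f 0 + real CARD('n) * f (2 + 2 / real CARD('n))"
    "strictly_convex_on {0..4} f \<Longrightarrow>
      polarization f \<omega> = f 0 + real CARD('n) * f (2 + 2 / real CARD('n)) \<Longrightarrow>
      regular_simplex_vertices \<omega>"
    by (auto simp: V_def d_def)
qed

theorem theorem2p2:
  fixes f :: "real \<Rightarrow> real" and \<omega>s :: "(real ^ 'n) set"
  assumes "CARD('n) \<ge> 2"
    and "antimono_on {0<..4} f"
    and "convex_on {0<..4} f"
    and "f differentiable_on {0<..<4}"
    and "convex_on {0<..<4} (deriv f)"
    and "(f \<longlongrightarrow> f 0) (at_right 0)"
    and "regular_simplex_vertices \<omega>s"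
  shows "(\<forall>\<omega> :: (real ^ 'n) set. simplex_configuration \<omega> \<longrightarrow> polarization f \<omega> \<le> polarization f \<omega>s) \<and>
    max_polarization TYPE('n) f = polarization f \<omega>s \<and>
    polarization f \<omega>s = f 0 + real CARD('n) * f (2 + 2 / real CARD('n)) \<and>
    (strictly_convex_on {0<..4} f \<longrightarrow>
      (\<forall>\<omega> :: (real ^ 'n) set. simplex_configuration \<omega> \<longrightarrow>
        (polarization f \<omega> = polarization f \<omega>s \<longleftrightarrow> regular_simplex_vertices \<omega>)))"
proof -
  have anti: "antimono_on {0..4} f"
    by (rule antimono_on_include_left_endpoint[OF assms(2) assms(6)])
  have conv: "convex_on {0..4} f"
    by (rule convex_on_include_left_endpoint[OF assms(3) assms(6)])
  have cont: "continuous_on {0..4} f"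
    by (rule continuous_on_if_convex_antimono[OF _ anti conv assms(6)]) simp
  have der: "(f has_real_derivative deriv f t) (at t)" if "0 < t" "t < 4" for t
  proof -
    have "f differentiable (at t within {0<..<4})"
      using assms(4) that by (auto simp: differentiable_on_def)
    moreover have "at t within {0<..<4} = at t" using that by (intro at_within_open) auto
    ultimately show ?thesis using DERIV_deriv_iff_real_differentiable by metis
  qed
  note regular = polarization_regular_simplex[OF assms(1) cont der assms(5)]
  note upper = polarization_simplex_configuration[OF assms(1) anti conv cont]
  have \<omega>s: "polarization f \<omega>s = f 0 + real CARD('n) * f (2 + 2 / real CARD('n))"
    by (rule regular[OF _ _ assms(7)])
  have "simplex_configuration \<omega>s" using assms(7) by (simp add: regular_simplex_vertices_def)
  then have "max_polarization TYPE('n) f = polarization f \<omega>s"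
    unfolding max_polarization_def
    by (intro cSup_eq_maximum imageI) (use upper(1) \<omega>s in auto)
  moreover have "polarization f \<omega> = polarization f \<omega>s \<longleftrightarrow> regular_simplex_vertices \<omega>"
    if "strictly_convex_on {0<..4} f" "simplex_configuration \<omega>" for \<omega> :: "(real ^ 'n) set"
    using upper(2)[OF that(2) strictly_convex_on_include_left_endpoint[OF conv that(1)]]
      regular[of \<omega>] \<omega>s by auto
  ultimately show ?thesis using upper(1) \<omega>s by auto
qed

end
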